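(* Let $G$ be a SIN group, and let $\{\mathcal F_n\}$ be a countable family of filters on $G$, each one of which admits an $\omega^\omega$-base. Suppose the topology on $G$ is the finest SIN group topology with regard to which $\mathcal F_n\to e$ for every $n$. Then $G$ has a local $\omega^\omega$-base at the identity.
   Context: A SIN group is a topological group whose left and right uniformities coincide; equivalently, the identity has a base of neighbourhoods invariant under all inner automorphisms. A SIN group topology on a group is a group topology making it a SIN group. The set $\omega^\omega$ of all functions $\omega\to\omega$ carries the pointwise partial order. A filter $\mathcal F$ admits an $\omega^\omega$-base if there is a family $\{F_\alpha:\alpha\in\omega^\omega\}\subseteq\mathcal F$ such that $\alpha\le\beta$ implies $F_\beta\subseteq F_\alpha$ and every element of $\mathcal F$ contains some $F_\alpha$. A topological group has a local $\omega^\omega$-base if the filter of neighbourhoods of its identity $e$ admits an $\omega^\omega$-base. $\mathcal F\to e$ means that every neighbourhood of $e$ belongs to $\mathcal F$. *)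

theory Defs
  imports "HOL-Analysis.Analysis" "HOL-Algebra.Group"
begin

text \<open>Topological groups with explicit carrier, so that several group topologies on one group can
  be compared. No separation axiom is assumed.\<close>

locale topological_group = group G for G (structure) and T :: "'a topology" +
  assumes topspace_eq: "topspace T = carrier G"
    and continuous_mult: "continuous_map (prod_topology T T) T (\<lambda>(x, y). x \<otimes> y)"
    and continuous_inv: "continuous_map T T (\<lambda>x. inv x)"

text \<open>A uniformity on the carrier is represented by its filter of entourages. As a filter on the
  ambient type, it is concentrated on pairs from the carrier by the second factor; see
  \<open>eventually_left_uniformity\<close> and \<open>eventually_right_uniformity\<close> below.\<close>

definition left_uniformity :: "('a, 'b) monoid_scheme \<Rightarrow> 'a topology \<Rightarrow> ('a \<times> 'a) filter" where
  "left_uniformity G T = inf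
     (filtercomap (\<lambda>(x, y). inv\<^bsub>G\<^esub> x \<otimes>\<^bsub>G\<^esub> y) (nhdsin T \<one>\<^bsub>G\<^esub>))
     (principal (carrier G \<times> carrier G))"

definition right_uniformity :: "('a, 'b) monoid_scheme \<Rightarrow> 'a topology \<Rightarrow> ('a \<times> 'a) filter" where
  "right_uniformity G T = inf
     (filtercomap (\<lambda>(x, y). y \<otimes>\<^bsub>G\<^esub> inv\<^bsub>G\<^esub> x) (nhdsin T \<one>\<^bsub>G\<^esub>))
     (principal (carrier G \<times> carrier G))"

locale SIN_group = topological_group G T for G (structure) and T :: "'a topology" +
  assumes uniformities_coincide: "left_uniformity G T = right_uniformity G T"

text \<open>The order on \<^typ>\<open>nat \<Rightarrow> nat\<close> is the pointwise one. A set \<open>A\<close> is an element of a filter \<open>F\<close>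
  iff \<open>\<forall>\<^sub>F x in F. x \<in> A\<close>.\<close>

definition admits_omega_omega_base :: "'a filter \<Rightarrow> bool" where
  "admits_omega_omega_base F \<longleftrightarrow>
     (\<exists>B :: (nat \<Rightarrow> nat) \<Rightarrow> 'a set.
        (\<forall>\<alpha>. \<forall>\<^sub>F x in F. x \<in> B \<alpha>) \<and>
        (\<forall>\<alpha> \<beta>. \<alpha> \<le> \<beta> \<longrightarrow> B \<beta> \<subseteq> B \<alpha>) \<and>
        (\<forall>A. (\<forall>\<^sub>F x in F. x \<in> A) \<longrightarrow> (\<exists>\<alpha>. B \<alpha> \<subseteq> A)))"

definition has_local_omega_omega_base :: "('a, 'b) monoid_scheme \<Rightarrow> 'a topology \<Rightarrow> bool" where
  "has_local_omega_omega_base G T \<longleftrightarrow> admits_omega_omega_base (nhdsin T \<one>\<^bsub>G\<^esub>)"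

text \<open>In terms of sets, \<open>F \<le> nhdsin T e\<close> says that every neighbourhood of \<open>e\<close> belongs to \<open>F\<close>.\<close>

definition converges_to_identity ::
    "('a, 'b) monoid_scheme \<Rightarrow> 'a topology \<Rightarrow> 'a filter \<Rightarrow> bool" where
  "converges_to_identity G T F \<longleftrightarrow> F \<le> nhdsin T \<one>\<^bsub>G\<^esub>"

definition finest_SIN_topology ::
    "('a, 'b) monoid_scheme \<Rightarrow> 'i set \<Rightarrow> ('i \<Rightarrow> 'a filter) \<Rightarrow> 'a topology \<Rightarrow> bool" where
  "finest_SIN_topology G I \<F> T \<longleftrightarrow>
     SIN_group G T \<and> (\<forall>i\<in>I. converges_to_identity G T (\<F> i)) \<and>
     (\<forall>T'. SIN_group G T' \<and> (\<forall>i\<in>I. converges_to_identity G T' (\<F> i)) \<longrightarrow>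
        (\<forall>U. openin T' U \<longrightarrow> openin T U))"

context topological_group
begin

lemma one_in_topspace: "\<one> \<in> topspace T"
  by (simp add: topspace_eq)

lemma openin_subset_carrier: "openin T U \<Longrightarrow> U \<subseteq> carrier G"
  using openin_subset topspace_eq by blast

lemma eventually_left_uniformity:
  "(\<forall>\<^sub>F p in left_uniformity G T. p \<in> E) \<longleftrightarrow>
     (\<exists>U. openin T U \<and> \<one> \<in> U \<and>
       {(x, y). x \<in> carrier G \<and> y \<in> carrier G \<and> inv x \<otimes> y \<in> U} \<subseteq> E)"
  (is "?L \<longleftrightarrow> ?R")
proof -
  have "?L \<longleftrightarrow> (\<exists>Q. (\<exists>U. openin T U \<and> \<one> \<in> U \<and> (\<forall>z\<in>U. Q z)) \<and>
      (\<forall>x y. Q (inv x \<otimes> y) \<longrightarrow> x \<in> carrier G \<and> y \<in> carrier G \<longrightarrow> (x, y) \<in> E))"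
    by (simp add: left_uniformity_def eventually_inf_principal eventually_filtercomap
        eventually_nhdsin one_in_topspace)
  also have "\<dots> \<longleftrightarrow> ?R"
  proof
    assume "\<exists>Q. (\<exists>U. openin T U \<and> \<one> \<in> U \<and> (\<forall>z\<in>U. Q z)) \<and>
      (\<forall>x y. Q (inv x \<otimes> y) \<longrightarrow> x \<in> carrier G \<and> y \<in> carrier G \<longrightarrow> (x, y) \<in> E)"
    then show ?R by blast
  next
    assume ?R
    then obtain U where "openin T U" "\<one> \<in> U"
      "{(x, y). x \<in> carrier G \<and> y \<in> carrier G \<and> inv x \<otimes> y \<in> U} \<subseteq> E" by blast
    then show "\<exists>Q. (\<exists>U. openin T U \<and> \<one> \<in> U \<and> (\<forall>z\<in>U. Q z)) \<and>
      (\<forall>x y. Q (inv x \<otimes> y) \<longrightarrow> x \<in> carrier G \<and> y \<in> carrier G \<longrightarrow> (x, y) \<in> E)"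
      by (intro exI[of _ "\<lambda>z. z \<in> U"]) blast
  qed
  finally show ?thesis .
qed

lemma eventually_right_uniformity:
  "(\<forall>\<^sub>F p in right_uniformity G T. p \<in> E) \<longleftrightarrow>
     (\<exists>U. openin T U \<and> \<one> \<in> U \<and>
       {(x, y). x \<in> carrier G \<and> y \<in> carrier G \<and> y \<otimes> inv x \<in> U} \<subseteq> E)"
  (is "?L \<longleftrightarrow> ?R")
proof -
  have "?L \<longleftrightarrow> (\<exists>Q. (\<exists>U. openin T U \<and> \<one> \<in> U \<and> (\<forall>z\<in>U. Q z)) \<and>
      (\<forall>x y. Q (y \<otimes> inv x) \<longrightarrow> x \<in> carrier G \<and> y \<in> carrier G \<longrightarrow> (x, y) \<in> E))"
    by (simp add: right_uniformity_def eventually_inf_principal eventually_filtercomap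
        eventually_nhdsin one_in_topspace)
  also have "\<dots> \<longleftrightarrow> ?R"
  proof
    assume "\<exists>Q. (\<exists>U. openin T U \<and> \<one> \<in> U \<and> (\<forall>z\<in>U. Q z)) \<and>
      (\<forall>x y. Q (y \<otimes> inv x) \<longrightarrow> x \<in> carrier G \<and> y \<in> carrier G \<longrightarrow> (x, y) \<in> E)"
    then show ?R by blast
  next
    assume ?R
    then obtain U where "openin T U" "\<one> \<in> U"
      "{(x, y). x \<in> carrier G \<and> y \<in> carrier G \<and> y \<otimes> inv x \<in> U} \<subseteq> E" by blast
    then show "\<exists>Q. (\<exists>U. openin T U \<and> \<one> \<in> U \<and> (\<forall>z\<in>U. Q z)) \<and>
      (\<forall>x y. Q (y \<otimes> inv x) \<longrightarrow> x \<in> carrier G \<and> y \<in> carrier G \<longrightarrow> (x, y) \<in> E)"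
      by (intro exI[of _ "\<lambda>z. z \<in> U"]) blast
  qed
  finally show ?thesis .
qed

text \<open>The uniformities coincide iff the neighbourhoods of the identity can be shrunk uniformly under
  all inner automorphisms, i.e. iff the identity has a base of invariant neighbourhoods.\<close>

lemma uniformities_coincide_iff:
  "left_uniformity G T = right_uniformity G T \<longleftrightarrow>
     (\<forall>U. openin T U \<and> \<one> \<in> U \<longrightarrow>
       (\<exists>V. openin T V \<and> \<one> \<in> V \<and> (\<forall>g\<in>carrier G. \<forall>v\<in>V. g \<otimes> v \<otimes> inv g \<in> U)))"
  (is "?L \<longleftrightarrow> ?R")
proof
  assume L: ?L
  show ?R
  proof (intro allI impI)
    fix U assume U: "openin T U \<and> \<one> \<in> U"
    let ?E = "{(x, y). x \<in> carrier G \<and> y \<in> carrier G \<and> y \<otimes> inv x \<in> U}"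
    have "\<forall>\<^sub>F p in left_uniformity G T. p \<in> ?E"
      unfolding L eventually_right_uniformity using U by blast
    then obtain V where V: "openin T V" "\<one> \<in> V"
      "{(x, y). x \<in> carrier G \<and> y \<in> carrier G \<and> inv x \<otimes> y \<in> V} \<subseteq> ?E"
      unfolding eventually_left_uniformity by blast
    have "g \<otimes> v \<otimes> inv g \<in> U" if "g \<in> carrier G" "v \<in> V" for g v
    proof -
      have v: "v \<in> carrier G" using that V openin_subset_carrier by blast
      have "inv g \<otimes> (g \<otimes> v) = v"
        using that v by (metis inv_closed l_inv l_one m_assoc)
      then have "(g, g \<otimes> v) \<in> {(x, y). x \<in> carrier G \<and> y \<in> carrier G \<and> inv x \<otimes> y \<in> V}"
        using that v by simp
      then have "(g, g \<otimes> v) \<in> ?E"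
        using V(3) by (rule rev_subsetD)
      then show ?thesis by simp
    qed
    then show "\<exists>V. openin T V \<and> \<one> \<in> V \<and> (\<forall>g\<in>carrier G. \<forall>v\<in>V. g \<otimes> v \<otimes> inv g \<in> U)"
      using V by blast
  qed
next
  assume R: ?R
  have "(\<forall>\<^sub>F p in left_uniformity G T. p \<in> E) \<longleftrightarrow> (\<forall>\<^sub>F p in right_uniformity G T. p \<in> E)" for E
  proof
    assume "\<forall>\<^sub>F p in left_uniformity G T. p \<in> E"
    then obtain U where U: "openin T U" "\<one> \<in> U"
      "{(x, y). x \<in> carrier G \<and> y \<in> carrier G \<and> inv x \<otimes> y \<in> U} \<subseteq> E"
      unfolding eventually_left_uniformity by blast
    with R obtain V where V: "openin T V" "\<one> \<in> V"
      "\<forall>g\<in>carrier G. \<forall>v\<in>V. g \<otimes> v \<otimes> inv g \<in> U" by meson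
    have "inv x \<otimes> y \<in> U" if "x \<in> carrier G" "y \<in> carrier G" "y \<otimes> inv x \<in> V" for x y
    proof -
      have "inv x \<otimes> (y \<otimes> inv x) \<otimes> inv (inv x) = inv x \<otimes> y"
        using that by (metis inv_closed inv_inv l_inv m_assoc m_closed r_one)
      then show ?thesis using V(3) that by (metis inv_closed)
    qed
    then show "\<forall>\<^sub>F p in right_uniformity G T. p \<in> E"
      unfolding eventually_right_uniformity using U V by (intro exI[of _ V]) blast
  next
    assume "\<forall>\<^sub>F p in right_uniformity G T. p \<in> E"
    then obtain U where U: "openin T U" "\<one> \<in> U"
      "{(x, y). x \<in> carrier G \<and> y \<in> carrier G \<and> y \<otimes> inv x \<in> U} \<subseteq> E"
      unfolding eventually_right_uniformity by blast
    with R obtain V where V: "openin T V" "\<one> \<in> V"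
      "\<forall>g\<in>carrier G. \<forall>v\<in>V. g \<otimes> v \<otimes> inv g \<in> U" by meson
    have "y \<otimes> inv x \<in> U" if "x \<in> carrier G" "y \<in> carrier G" "inv x \<otimes> y \<in> V" for x y
    proof -
      have "x \<otimes> (inv x \<otimes> y) \<otimes> inv x = y \<otimes> inv x"
        using that by (metis inv_closed l_one m_assoc m_closed r_inv)
      then show ?thesis using V(3) that by metis
    qed
    then show "\<forall>\<^sub>F p in left_uniformity G T. p \<in> E"
      unfolding eventually_left_uniformity using U V by (intro exI[of _ V]) blast
  qed
  from this[of "{p. P p}" for P] show ?L
    by (simp add: filter_eq_iff)
qed

end

end

theory Submission
  imports Defs "HOL-Algebra.Coset"
begin

text \<open>The supremum of countably many filters with an \<open>\<omega>\<^sup>\<omega>\<close>-base has such a base \<open>B\<close>, so one may work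
  with a single filter. Let \<open>C \<alpha>\<close> consist of \<open>\<one>\<close> and all conjugates of elements of \<open>B \<alpha>\<close> and of
  their inverses. For a sequence \<open>\<gamma>\<close> in \<open>\<omega>\<^sup>\<omega>\<close> put \<open>U \<gamma> = (\<Union>n. C (\<gamma> 0) \<cdots> C (\<gamma> (n - 1)))\<close>.
  Invariant sets commute, so \<open>U \<beta> \<cdot> U \<beta> \<subseteq> U \<gamma>\<close> as soon as \<open>\<beta> n\<close> dominates \<open>\<gamma> (2 n)\<close> and
  \<open>\<gamma> (2 n + 1)\<close>. Hence the sets \<open>U \<gamma>\<close> form a base at the identity of a SIN group topology to which
  the filter converges, and they are neighbourhoods of the identity in \<open>T\<close>. Conversely, a
  neighbourhood \<open>W\<close> in \<open>T\<close> starts a chain with \<open>W (n + 1) \<cdot> W (n + 1) \<subseteq> W n\<close>, and choosing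
  \<open>C (\<gamma> n) \<subseteq> W (n + 1)\<close> gives \<open>U \<gamma> \<subseteq> W\<close>. Finally \<open>(\<omega>\<^sup>\<omega>)\<^sup>\<omega>\<close> and \<open>\<omega>\<^sup>\<omega>\<close> are isomorphic orders.\<close>

section \<open>Countable suprema of filters\<close>

text \<open>A set belongs to the supremum iff it belongs to every \<open>F i\<close>, so unions of
  one base set per filter form a base. Such a choice is a countable family of functions, which
  pairing on \<open>nat\<close> packs into a single one.\<close>

lemma admits_omega_omega_base_SUP:
  assumes I: "countable I" and F: "\<And>i. i \<in> I \<Longrightarrow> admits_omega_omega_base (F i)"
  shows "admits_omega_omega_base (SUP i\<in>I. F i)"
proof -
  have "\<forall>i\<in>I. \<exists>B :: (nat \<Rightarrow> nat) \<Rightarrow> 'b set.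
        (\<forall>\<alpha>. \<forall>\<^sub>F x in F i. x \<in> B \<alpha>) \<and>
        (\<forall>\<alpha> \<beta>. \<alpha> \<le> \<beta> \<longrightarrow> B \<beta> \<subseteq> B \<alpha>) \<and>
        (\<forall>A. (\<forall>\<^sub>F x in F i. x \<in> A) \<longrightarrow> (\<exists>\<alpha>. B \<alpha> \<subseteq> A))"
    using F unfolding admits_omega_omega_base_def by blast
  then obtain B :: "'a \<Rightarrow> (nat \<Rightarrow> nat) \<Rightarrow> 'b set" where
    B1: "\<And>i \<alpha>. i \<in> I \<Longrightarrow> \<forall>\<^sub>F x in F i. x \<in> B i \<alpha>" and
    B2: "\<And>i \<alpha> \<beta>. i \<in> I \<Longrightarrow> \<alpha> \<le> \<beta> \<Longrightarrow> B i \<beta> \<subseteq> B i \<alpha>" and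
    B3: "\<And>i A. i \<in> I \<Longrightarrow> (\<forall>\<^sub>F x in F i. x \<in> A) \<Longrightarrow> \<exists>\<alpha>. B i \<alpha> \<subseteq> A"
    by metis
  \<comment> \<open>\<open>s \<alpha> i\<close> is the row of \<open>\<alpha>\<close> reserved for
    \<open>i\<close>; distinct indices get distinct rows because \<open>to_nat_on I\<close> is
    injective on the countable set \<open>I\<close>.\<close>
  define s where "s \<alpha> i = (\<lambda>k. \<alpha> (prod_encode (to_nat_on I i, k)))" for \<alpha> :: "nat \<Rightarrow> nat" and i
  define D where "D \<alpha> = (\<Union>i\<in>I. B i (s \<alpha> i))" for \<alpha>
  have "\<forall>\<^sub>F x in (SUP i\<in>I. F i). x \<in> D \<alpha>" for \<alpha>
    unfolding eventually_Sup
  proof safe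
    fix i assume "i \<in> I"
    then show "\<forall>\<^sub>F x in F i. x \<in> D \<alpha>"
      by (intro eventually_mono[OF B1[of i "s \<alpha> i"]]) (auto simp: D_def)
  qed
  moreover have "D \<beta> \<subseteq> D \<alpha>" if "\<alpha> \<le> \<beta>" for \<alpha> \<beta>
  proof -
    have "s \<alpha> i \<le> s \<beta> i" for i using that by (simp add: s_def le_fun_def)
    then show ?thesis using B2 unfolding D_def by blast
  qed
  moreover have "\<exists>\<alpha>. D \<alpha> \<subseteq> A" if A: "\<forall>\<^sub>F x in (SUP i\<in>I. F i). x \<in> A" for A
  proof -
    have "\<forall>i\<in>I. \<exists>\<gamma>. B i \<gamma> \<subseteq> A"
      using A B3 by (simp add: eventually_Sup)
    then obtain \<gamma> where \<gamma>: "\<And>i. i \<in> I \<Longrightarrow> B i (\<gamma> i) \<subseteq> A" by metis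
    \<comment> \<open>Independently chosen functions \<open>\<gamma> i\<close> are glued into one
      \<open>\<alpha>\<close> having them as its rows.\<close>
    define \<alpha> where "\<alpha> m = (case prod_decode m of (n, k) \<Rightarrow> \<gamma> (from_nat_into I n) k)" for m
    have "s \<alpha> i = \<gamma> i" if "i \<in> I" for i
      using that I by (simp add: s_def \<alpha>_def)
    then show ?thesis using \<gamma> unfolding D_def by (intro exI[of _ \<alpha>]) auto
  qed
  ultimately show ?thesis unfolding admits_omega_omega_base_def by blast
qed

context group
begin

section \<open>Symmetric invariant sets\<close>

lemma mult_inv_cancel_left:
  assumes "x \<in> carrier G" "y \<in> carrier G"
  shows "inv x \<otimes> (x \<otimes> y) = y" "x \<otimes> (inv x \<otimes> y) = y"
  using assms by (simp_all add: m_assoc[symmetric])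

definition sym_invariant :: "'a set \<Rightarrow> bool" where
  "sym_invariant A \<longleftrightarrow> A \<subseteq> carrier G \<and> \<one> \<in> A \<and> (\<forall>x\<in>A. inv x \<in> A) \<and>
     (\<forall>g\<in>carrier G. \<forall>x\<in>A. g \<otimes> x \<otimes> inv g \<in> A)"

lemma sym_invariantD:
  assumes "sym_invariant A"
  shows "A \<subseteq> carrier G" "\<one> \<in> A" "x \<in> A \<Longrightarrow> inv x \<in> A"
    "g \<in> carrier G \<Longrightarrow> x \<in> A \<Longrightarrow> g \<otimes> x \<otimes> inv g \<in> A"
  using assms by (auto simp: sym_invariant_def)

lemma sym_invariant_conj':
  assumes "sym_invariant A" "g \<in> carrier G" "x \<in> A"
  shows "inv g \<otimes> x \<otimes> g \<in> A"
  using sym_invariantD(4)[OF assms(1), of "inv g" x] assms(2,3) by simp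

lemma set_multI: "a \<in> A \<Longrightarrow> b \<in> B \<Longrightarrow> a \<otimes> b \<in> A <#> B"
  unfolding set_mult_def by blast

lemma subset_set_mult:
  assumes "A \<subseteq> carrier G" "\<one> \<in> B"
  shows "A \<subseteq> A <#> B"
proof
  fix x assume "x \<in> A"
  then show "x \<in> A <#> B" using set_multI[OF _ assms(2), of x A] assms(1) by auto
qed

text \<open>Moving \<open>b\<close> past \<open>a\<close> replaces \<open>a\<close> by a conjugate,
  which stays in \<open>A\<close>.\<close>

lemma set_mult_commute_of_sym_invariant:
  assumes A: "sym_invariant A" and B: "B \<subseteq> carrier G"
  shows "A <#> B = B <#> A"
proof -
  note AG = sym_invariantD(1)[OF A]
  have "a \<otimes> b \<in> B <#> A" "b \<otimes> a \<in> A <#> B" if ab: "a \<in> A" "b \<in> B" for a b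
  proof -
    have G: "a \<in> carrier G" "b \<in> carrier G" using ab AG B by auto
    have "a \<otimes> b = b \<otimes> (inv b \<otimes> a \<otimes> b)" "b \<otimes> a = (b \<otimes> a \<otimes> inv b) \<otimes> b"
      using G by (simp_all add: m_assoc mult_inv_cancel_left)
    then show "a \<otimes> b \<in> B <#> A" "b \<otimes> a \<in> A <#> B"
      using ab sym_invariant_conj'[OF A G(2) ab(1)] sym_invariantD(4)[OF A G(2) ab(1)]
      by (metis set_multI)+
  qed
  then have "A <#> B \<subseteq> B <#> A" "B <#> A \<subseteq> A <#> B"
    by (subst set_mult_def, blast)+
  then show ?thesis by (rule subset_antisym)
qed

text \<open>Inversion reverses the factors and lands in \<open>B <#> A\<close>, which equals
  \<open>A <#> B\<close> by commutation. Conjugation is a homomorphism, so it acts on each factor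
  separately.\<close>

lemma sym_invariant_set_mult:
  assumes A: "sym_invariant A" and B: "sym_invariant B"
  shows "sym_invariant (A <#> B)"
proof -
  note AG = sym_invariantD(1)[OF A] and BG = sym_invariantD(1)[OF B]
  have "inv x \<in> A <#> B" if x: "x \<in> A <#> B" for x
  proof -
    obtain a b where ab: "a \<in> A" "b \<in> B" "x = a \<otimes> b" using x by (auto simp: set_mult_def)
    then have "inv x = inv b \<otimes> inv a" using AG BG by (auto intro: inv_mult_group)
    then have "inv x \<in> B <#> A"
      using ab sym_invariantD(3)[OF A] sym_invariantD(3)[OF B] by (auto simp: set_mult_def)
    then show ?thesis using set_mult_commute_of_sym_invariant[OF A BG] by simp
  qed
  moreover have "g \<otimes> x \<otimes> inv g \<in> A <#> B" if x: "x \<in> A <#> B" and g: "g \<in> carrier G" for x g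
  proof -
    obtain a b where ab: "a \<in> A" "b \<in> B" "x = a \<otimes> b" using x by (auto simp: set_mult_def)
    have abG: "a \<in> carrier G" "b \<in> carrier G" using ab AG BG by auto
    have "(g \<otimes> a \<otimes> inv g) \<otimes> (g \<otimes> b \<otimes> inv g) = g \<otimes> x \<otimes> inv g"
      using abG g ab(3) by (simp add: m_assoc mult_inv_cancel_left)
    moreover have "(g \<otimes> a \<otimes> inv g) \<otimes> (g \<otimes> b \<otimes> inv g) \<in> A <#> B"
      using ab g by (intro set_multI sym_invariantD(4)[OF A] sym_invariantD(4)[OF B])
    ultimately show ?thesis by simp
  qed
  moreover have "\<one> \<in> A <#> B"
    using set_multI[OF sym_invariantD(2)[OF A] sym_invariantD(2)[OF B]] by simp
  ultimately show ?thesis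
    using set_mult_closed[OF AG BG] by (simp add: sym_invariant_def)
qed

text \<open>A base set of a filter on the ambient type may contain elements outside the group, hence
  the intersection with \<open>carrier G\<close>. The identity is inserted because \<open>A\<close>
  need not contain it.\<close>

definition sym_invariant_hull :: "'a set \<Rightarrow> 'a set" where
  "sym_invariant_hull A = insert \<one>
     {g \<otimes> y \<otimes> inv g | g x y. g \<in> carrier G \<and> x \<in> A \<inter> carrier G \<and> y \<in> {x, inv x}}"

lemma sym_invariant_hull_mono: "A \<subseteq> B \<Longrightarrow> sym_invariant_hull A \<subseteq> sym_invariant_hull B"
  unfolding sym_invariant_hull_def by blast

lemma subset_sym_invariant_hull: "A \<inter> carrier G \<subseteq> sym_invariant_hull A"
proof
  fix x assume "x \<in> A \<inter> carrier G"
  then show "x \<in> sym_invariant_hull A"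
    unfolding sym_invariant_hull_def by (intro insertI2 CollectI exI[of _ \<one>] exI[of _ x]) simp
qed

text \<open>Conjugating a conjugate gives a conjugate by the product, and inversion commutes with
  conjugation while exchanging \<open>x\<close> and \<open>inv x\<close>.\<close>

lemma sym_invariant_hull: "sym_invariant (sym_invariant_hull A)"
proof -
  have c: "h \<otimes> (g \<otimes> y \<otimes> inv g) \<otimes> inv h = (h \<otimes> g) \<otimes> y \<otimes> inv (h \<otimes> g)"
    if "h \<in> carrier G" "g \<in> carrier G" "y \<in> carrier G" for h g y
    using that by (simp add: inv_mult_group m_assoc)
  have i: "inv (g \<otimes> y \<otimes> inv g) = g \<otimes> inv y \<otimes> inv g" if "g \<in> carrier G" "y \<in> carrier G" for g y
    using that by (simp add: inv_mult_group m_assoc)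
  have inH: "g \<otimes> y \<otimes> inv g \<in> sym_invariant_hull A"
    if "g \<in> carrier G" "x \<in> A \<inter> carrier G" "y \<in> {x, inv x}" for g x y
    using that unfolding sym_invariant_hull_def by blast
  have *: "inv z \<in> sym_invariant_hull A \<and> (\<forall>h\<in>carrier G. h \<otimes> z \<otimes> inv h \<in> sym_invariant_hull A)"
    if z: "z \<in> sym_invariant_hull A" for z
  proof (cases "z = \<one>")
    case True
    then show ?thesis by (simp add: sym_invariant_hull_def)
  next
    case False
    then obtain g x y where g: "g \<in> carrier G" and x: "x \<in> A \<inter> carrier G" and y: "y \<in> {x, inv x}"
      and z_eq: "z = g \<otimes> y \<otimes> inv g"
      using z unfolding sym_invariant_hull_def by blast
    have yG: "y \<in> carrier G" and iy: "inv y \<in> {x, inv x}" using x y by auto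
    show ?thesis
      unfolding z_eq using inH[OF g x iy] inH[OF m_closed[OF _ g] x y] by (simp add: c i g yG)
  qed
  have "sym_invariant_hull A \<subseteq> carrier G" "\<one> \<in> sym_invariant_hull A"
    by (auto simp: sym_invariant_hull_def)
  then show ?thesis
    unfolding sym_invariant_def using * by blast
qed

section \<open>Finite products of a sequence of sets\<close>

primrec partial_set_prod :: "(nat \<Rightarrow> 'a set) \<Rightarrow> nat \<Rightarrow> 'a set" where
  "partial_set_prod A 0 = {\<one>}"
| "partial_set_prod A (Suc n) = partial_set_prod A n <#> A n"

lemma sym_invariant_partial_set_prod:
  "(\<And>n. sym_invariant (A n)) \<Longrightarrow> sym_invariant (partial_set_prod A n)"
proof (induction n)
  case 0
  then show ?case by (simp add: sym_invariant_def)
qed (simp add: sym_invariant_set_mult)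

lemma partial_set_prod_mono:
  "(\<And>n. A n \<subseteq> B n) \<Longrightarrow> partial_set_prod A n \<subseteq> partial_set_prod B n"
  by (induction n) (simp_all add: mono_set_mult)

lemma incseq_partial_set_prod:
  assumes A: "\<And>n. sym_invariant (A n)"
  shows "incseq (partial_set_prod A)"
proof (rule incseq_SucI)
  fix n
  have "partial_set_prod A n \<subseteq> carrier G"
    by (intro sym_invariantD(1) sym_invariant_partial_set_prod A)
  then show "partial_set_prod A n \<subseteq> partial_set_prod A (Suc n)"
    using sym_invariantD(2)[OF A[of n]] by (simp add: subset_set_mult)
qed

text \<open>In the square of the product, commutation gathers the two copies of each
  \<open>B n\<close> side by side; they then fit into the adjacent factors \<open>A (2 * n)\<close>
  and \<open>A (2 * n + 1)\<close>.\<close>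

lemma partial_set_prod_mult_subset:
  assumes A: "\<And>n. sym_invariant (A n)" and B: "\<And>n. sym_invariant (B n)"
    and sub: "\<And>n. B n \<subseteq> A (2 * n)" "\<And>n. B n \<subseteq> A (2 * n + 1)"
  shows "partial_set_prod B n <#> partial_set_prod B n \<subseteq> partial_set_prod A (2 * n)"
proof (induction n)
  case 0
  then show ?case by (simp add: set_mult_def)
next
  case (Suc n)
  let ?P = "partial_set_prod B n"
  have P: "sym_invariant ?P" by (rule sym_invariant_partial_set_prod[OF B])
  note cl = sym_invariantD(1)[OF P] sym_invariantD(1)[OF B[of n]]
  have "(?P <#> B n) <#> (?P <#> B n) = ?P <#> (B n <#> ?P) <#> B n"
    using cl by (simp add: set_mult_assoc set_mult_closed)
  also have "\<dots> = ?P <#> (?P <#> B n) <#> B n"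
    using set_mult_commute_of_sym_invariant[OF P cl(2)] by simp
  also have "\<dots> = (?P <#> ?P) <#> B n <#> B n"
    using cl by (simp add: set_mult_assoc set_mult_closed)
  also have "\<dots> \<subseteq> partial_set_prod A (2 * n) <#> A (2 * n) <#> A (2 * n + 1)"
    by (intro mono_set_mult Suc.IH sub)
  finally show ?case by simp
qed

text \<open>The shifted index in \<open>A n \<subseteq> W (Suc n)\<close> leaves room for a second
  factor \<open>W (Suc n)\<close>, so that both together still fit into \<open>W n\<close>.\<close>

lemma partial_set_prod_subset:
  assumes W: "\<And>n. W n \<subseteq> carrier G" "\<And>n. W (Suc n) <#> W (Suc n) \<subseteq> W n" "\<And>n. \<one> \<in> W n"
    and A: "\<And>n. A n \<subseteq> W (Suc n)"
  shows "partial_set_prod A n \<subseteq> W 0"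
proof -
  have cl: "A n \<subseteq> carrier G" for n using A W(1) by blast
  have Pcl: "partial_set_prod A n \<subseteq> carrier G" for n
    by (induction n) (simp_all add: set_mult_closed cl)
  \<comment> \<open>The extra factor \<open>W n\<close> makes the induction go through: it absorbs the next factor.\<close>
  have "partial_set_prod A n <#> W n \<subseteq> W 0"
  proof (induction n)
    case 0
    show ?case using W(1)[of 0] by (auto simp: set_mult_def)
  next
    case (Suc n)
    have "partial_set_prod A (Suc n) <#> W (Suc n) = partial_set_prod A n <#> (A n <#> W (Suc n))"
      using set_mult_assoc[OF Pcl cl W(1)] by simp
    also have "\<dots> \<subseteq> partial_set_prod A n <#> (W (Suc n) <#> W (Suc n))"
      by (intro mono_set_mult A order_refl)
    also have "\<dots> \<subseteq> partial_set_prod A n <#> W n"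
      by (intro mono_set_mult W order_refl)
    finally show ?case using Suc.IH by simp
  qed
  moreover have "partial_set_prod A n \<subseteq> partial_set_prod A n <#> W n"
    using Pcl W(3) by (rule subset_set_mult)
  ultimately show ?thesis by blast
qed

section \<open>The group topology given by a base of invariant sets\<close>

text \<open>Openness is tested by left translates; for a base of invariant sets, right translates
  give the same family. That this family is a topology is checked in
  \<open>openin_topology_of_base\<close>.\<close>

definition topology_of_base :: "'a set set \<Rightarrow> 'a topology" where
  "topology_of_base N =
     topology (\<lambda>U. U \<subseteq> carrier G \<and> (\<forall>x\<in>U. \<exists>V\<in>N. x <# V \<subseteq> U))"

text \<open>These are the usual axioms for a neighbourhood base at the identity;
  \<open>sym_invariant\<close> covers both the inversion axiom and the conjugation axiom, the latter
  uniformly in the conjugating element.\<close>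

context
  fixes N :: "'a set set"
  assumes nonempty: "N \<noteq> {}"
    and directed: "\<And>U V. U \<in> N \<Longrightarrow> V \<in> N \<Longrightarrow> \<exists>W\<in>N. W \<subseteq> U \<inter> V"
    and invariant: "\<And>U. U \<in> N \<Longrightarrow> sym_invariant U"
    and square: "\<And>U. U \<in> N \<Longrightarrow> \<exists>V\<in>N. V <#> V \<subseteq> U"
begin

lemma openin_topology_of_base:
  "openin (topology_of_base N) U \<longleftrightarrow> U \<subseteq> carrier G \<and> (\<forall>x\<in>U. \<exists>V\<in>N. x <# V \<subseteq> U)"
proof -
  have "istopology (\<lambda>U. U \<subseteq> carrier G \<and> (\<forall>x\<in>U. \<exists>V\<in>N. x <# V \<subseteq> U))"
    unfolding istopology_def
  proof (intro conjI allI impI)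
    fix S U
    assume S: "S \<subseteq> carrier G \<and> (\<forall>x\<in>S. \<exists>V\<in>N. x <# V \<subseteq> S)"
      and U: "U \<subseteq> carrier G \<and> (\<forall>x\<in>U. \<exists>V\<in>N. x <# V \<subseteq> U)"
    show "S \<inter> U \<subseteq> carrier G" using S by blast
    show "\<forall>x\<in>S \<inter> U. \<exists>V\<in>N. x <# V \<subseteq> S \<inter> U"
    proof
      fix x assume x: "x \<in> S \<inter> U"
      then obtain V V' where V: "V \<in> N" "V' \<in> N" "x <# V \<subseteq> S" "x <# V' \<subseteq> U" using S U by blast
      then obtain W where "W \<in> N" "W \<subseteq> V \<inter> V'" using directed by blast
      moreover from this have "x <# W \<subseteq> S \<inter> U" using V unfolding l_coset_def by blast
      ultimately show "\<exists>V\<in>N. x <# V \<subseteq> S \<inter> U" by blast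
    qed
  next
    fix K assume "\<forall>S\<in>K. S \<subseteq> carrier G \<and> (\<forall>x\<in>S. \<exists>V\<in>N. x <# V \<subseteq> S)"
    then show "\<Union>K \<subseteq> carrier G" "\<forall>x\<in>\<Union>K. \<exists>V\<in>N. x <# V \<subseteq> \<Union>K"
      by (blast, meson UnionE Union_upper order_trans)
  qed
  then show ?thesis by (simp add: topology_of_base_def)
qed

lemma topspace_topology_of_base: "topspace (topology_of_base N) = carrier G"
proof -
  have "openin (topology_of_base N) (carrier G)"
    using nonempty invariant[THEN sym_invariantD(1)] unfolding openin_topology_of_base l_coset_def
    by blast
  then show ?thesis
    using openin_topology_of_base openin_subset openin_topspace by (metis subset_antisym)
qed

text \<open>Members of \<open>N\<close> are not assumed open, so the open set is the interior of the
  translate. Its openness comes from \<open>square\<close>: if \<open>y <# W\<close> lies in the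
  translate and \<open>W' <#> W' \<subseteq> W\<close>, then every point of \<open>y <# W'\<close>
  is again interior.\<close>

lemma topology_of_base_nhd:
  assumes x: "x \<in> carrier G" and V: "V \<in> N"
  obtains U where "openin (topology_of_base N) U" "x \<in> U" "U \<subseteq> x <# V"
proof
  define U where "U = {y \<in> carrier G. \<exists>W\<in>N. y <# W \<subseteq> x <# V}"
  show "x \<in> U" using x V by (auto simp: U_def)
  show "U \<subseteq> x <# V"
  proof
    fix y assume "y \<in> U"
    then obtain W where W: "y \<in> carrier G" "W \<in> N" "y <# W \<subseteq> x <# V" by (auto simp: U_def)
    have "y \<otimes> \<one> \<in> y <# W" using sym_invariantD(2)[OF invariant[OF W(2)]] by (auto simp: l_coset_def)
    then show "y \<in> x <# V" using W by auto
  qed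
  show "openin (topology_of_base N) U" unfolding openin_topology_of_base
  proof (intro conjI ballI)
    show "U \<subseteq> carrier G" by (auto simp: U_def)
    fix y assume "y \<in> U"
    then obtain W where W: "y \<in> carrier G" "W \<in> N" "y <# W \<subseteq> x <# V" by (auto simp: U_def)
    obtain W' where W': "W' \<in> N" "W' <#> W' \<subseteq> W" using square[OF W(2)] by blast
    note cl = sym_invariantD(1)[OF invariant[OF W'(1)]]
    have "y \<otimes> w \<in> U" if w: "w \<in> W'" for w
    proof -
      have wG: "w \<in> carrier G" using w cl by blast
      have "(y \<otimes> w) \<otimes> v \<in> x <# V" if v: "v \<in> W'" for v
      proof -
        have "w \<otimes> v \<in> W" using w v W'(2) by (auto simp: set_mult_def)
        then have "y \<otimes> (w \<otimes> v) \<in> x <# V" using W(3) by (auto simp: l_coset_def)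
        then show ?thesis using m_assoc[OF W(1) wG, of v] v cl by auto
      qed
      then have "(y \<otimes> w) <# W' \<subseteq> x <# V" by (auto simp: l_coset_def)
      then show ?thesis using W(1) wG W'(1) by (auto simp: U_def)
    qed
    then show "\<exists>V\<in>N. y <# V \<subseteq> U" using W'(1) by (auto simp: l_coset_def)
  qed
qed

text \<open>Continuity reduces to moving small factors to the right, e.g.
  \<open>x v y w = (x y) (inv y v y) w\<close>; invariance absorbs the resulting conjugates. It also
  yields the criterion \<open>uniformities_coincide_iff\<close>.\<close>

lemma SIN_group_topology_of_base: "SIN_group G (topology_of_base N)"
proof -
  let ?T = "topology_of_base N"
  have mult: "continuous_map (prod_topology ?T ?T) ?T (\<lambda>(x, y). x \<otimes> y)"
    unfolding continuous_map_def
  proof (intro conjI allI impI)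
    show "(\<lambda>(x, y). x \<otimes> y) \<in> topspace (prod_topology ?T ?T) \<rightarrow> topspace ?T"
      by (auto simp: topspace_topology_of_base)
    fix O' assume "openin ?T O'"
    then have O': "\<And>z. z \<in> O' \<Longrightarrow> \<exists>V\<in>N. z <# V \<subseteq> O'" by (simp add: openin_topology_of_base)
    show "openin (prod_topology ?T ?T) {p \<in> topspace (prod_topology ?T ?T). (case p of (x, y) \<Rightarrow> x \<otimes> y) \<in> O'}"
      unfolding openin_prod_topology_alt
    proof (intro allI impI)
      fix x y assume "(x, y) \<in> {p \<in> topspace (prod_topology ?T ?T). (case p of (x, y) \<Rightarrow> x \<otimes> y) \<in> O'}"
      then have xy: "x \<in> carrier G" "y \<in> carrier G" "x \<otimes> y \<in> O'"
        by (auto simp: topspace_topology_of_base)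
      obtain W where W: "W \<in> N" "(x \<otimes> y) <# W \<subseteq> O'" using O'[OF xy(3)] by blast
      obtain V where V: "V \<in> N" "V <#> V \<subseteq> W" using square[OF W(1)] by blast
      note inv_V = invariant[OF V(1)]
      note cl = sym_invariantD(1)[OF inv_V]
      obtain A where A: "openin ?T A" "x \<in> A" "A \<subseteq> x <# V" using topology_of_base_nhd[OF xy(1) V(1)] .
      obtain B where B: "openin ?T B" "y \<in> B" "B \<subseteq> y <# V" using topology_of_base_nhd[OF xy(2) V(1)] .
      have "a \<otimes> b \<in> O'" if ab: "a \<in> A" "b \<in> B" for a b
      proof -
        obtain v w where vw: "v \<in> V" "w \<in> V" "a = x \<otimes> v" "b = y \<otimes> w"
          using ab A(3) B(3) unfolding l_coset_def by blast
        have G: "v \<in> carrier G" "w \<in> carrier G" using vw cl by auto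
        have "a \<otimes> b = (x \<otimes> y) \<otimes> ((inv y \<otimes> v \<otimes> y) \<otimes> w)"
          using G xy vw by (simp add: m_assoc mult_inv_cancel_left)
        moreover have "(inv y \<otimes> v \<otimes> y) \<otimes> w \<in> W"
          using V(2) vw sym_invariant_conj'[OF inv_V xy(2) vw(1)] by (auto simp: set_mult_def)
        ultimately show ?thesis using W(2) by (auto simp: l_coset_def)
      qed
      then show "\<exists>U V. openin ?T U \<and> openin ?T V \<and> x \<in> U \<and> y \<in> V \<and>
          U \<times> V \<subseteq> {p \<in> topspace (prod_topology ?T ?T). (case p of (x, y) \<Rightarrow> x \<otimes> y) \<in> O'}"
        using A B openin_subset[OF A(1)] openin_subset[OF B(1)]
        by (intro exI[of _ A] exI[of _ B]) auto
    qed
  qed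
  have inverse: "continuous_map ?T ?T (\<lambda>x. inv x)"
    unfolding continuous_map_def
  proof (intro conjI allI impI)
    show "(\<lambda>x. inv x) \<in> topspace ?T \<rightarrow> topspace ?T" by (auto simp: topspace_topology_of_base)
    fix O' assume "openin ?T O'"
    then have O': "\<And>z. z \<in> O' \<Longrightarrow> \<exists>V\<in>N. z <# V \<subseteq> O'" by (simp add: openin_topology_of_base)
    show "openin ?T {x \<in> topspace ?T. inv x \<in> O'}"
      unfolding openin_topology_of_base topspace_topology_of_base
    proof (intro conjI ballI)
      fix x assume "x \<in> {x \<in> carrier G. inv x \<in> O'}"
      then have x: "x \<in> carrier G" "inv x \<in> O'" by auto
      obtain V where V: "V \<in> N" "inv x <# V \<subseteq> O'" using O'[OF x(2)] by blast
      note inv_V = invariant[OF V(1)]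
      have "x \<otimes> v \<in> carrier G \<and> inv (x \<otimes> v) \<in> O'" if v: "v \<in> V" for v
      proof -
        have vG: "v \<in> carrier G" using v sym_invariantD(1)[OF inv_V] by blast
        have "inv (x \<otimes> v) = inv x \<otimes> (x \<otimes> inv v \<otimes> inv x)"
          using vG x by (simp add: inv_mult_group m_assoc mult_inv_cancel_left)
        then show ?thesis
          using V(2) vG x(1) sym_invariantD(4)[OF inv_V x(1) sym_invariantD(3)[OF inv_V v]]
          by (auto simp: l_coset_def)
      qed
      then have "x <# V \<subseteq> {x \<in> carrier G. inv x \<in> O'}" by (auto simp: l_coset_def)
      then show "\<exists>V\<in>N. x <# V \<subseteq> {x \<in> carrier G. inv x \<in> O'}" using V(1) by blast
    qed auto
  qed
  interpret tg: topological_group G ?T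
    by unfold_locales (use mult inverse topspace_topology_of_base in auto)
  have "left_uniformity G ?T = right_uniformity G ?T"
    unfolding tg.uniformities_coincide_iff
  proof (intro allI impI)
    fix U assume U: "openin ?T U \<and> \<one> \<in> U"
    then obtain W where W: "W \<in> N" "\<one> <# W \<subseteq> U" by (auto simp: openin_topology_of_base)
    note WG = sym_invariantD(1)[OF invariant[OF W(1)]]
    have one: "\<one> <# W = W" using WG by (rule lcos_mult_one)
    obtain V where V: "openin ?T V" "\<one> \<in> V" "V \<subseteq> W"
      using topology_of_base_nhd[OF one_closed W(1)] one by metis
    show "\<exists>V. openin ?T V \<and> \<one> \<in> V \<and> (\<forall>g\<in>carrier G. \<forall>v\<in>V. g \<otimes> v \<otimes> inv g \<in> U)"
      using V W(2) one sym_invariantD(4)[OF invariant[OF W(1)]] by (intro exI[of _ V]) blast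
  qed
  then show ?thesis by unfold_locales
qed

end

end

section \<open>Neighbourhoods of the identity in a SIN group\<close>

context topological_group
begin

lemma square_nhd:
  assumes "openin T U" "\<one> \<in> U"
  obtains V where "openin T V" "\<one> \<in> V" "V <#> V \<subseteq> U"
proof -
  have "openin (prod_topology T T) {p \<in> topspace (prod_topology T T). (case p of (x, y) \<Rightarrow> x \<otimes> y) \<in> U}"
    using continuous_mult assms(1) by (simp add: continuous_map_def)
  moreover have "(\<one>, \<one>) \<in> {p \<in> topspace (prod_topology T T). (case p of (x, y) \<Rightarrow> x \<otimes> y) \<in> U}"
    using assms(2) one_in_topspace by simp
  ultimately obtain A B where AB: "openin T A" "openin T B" "\<one> \<in> A" "\<one> \<in> B"
    "A \<times> B \<subseteq> {p \<in> topspace (prod_topology T T). (case p of (x, y) \<Rightarrow> x \<otimes> y) \<in> U}"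
    unfolding openin_prod_topology_alt by meson
  show thesis
    by (rule that[of "A \<inter> B"]) (use AB in \<open>auto simp: set_mult_def\<close>)
qed

end

text \<open>The SIN condition controls all conjugates of elements of \<open>W\<close> at once.
  Intersecting \<open>W\<close> with its preimage under inversion controls the conjugates of
  inverses too.\<close>

lemma (in SIN_group) sym_invariant_hull_nhd:
  assumes U: "openin T U" "\<one> \<in> U"
  obtains V where "openin T V" "\<one> \<in> V" "sym_invariant_hull V \<subseteq> U"
proof -
  obtain W where W: "openin T W" "\<one> \<in> W" "\<forall>g\<in>carrier G. \<forall>v\<in>W. g \<otimes> v \<otimes> inv g \<in> U"
    using uniformities_coincide uniformities_coincide_iff U by metis
  let ?V = "W \<inter> {x \<in> topspace T. inv x \<in> W}"
  have "openin T ?V"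
    using W(1) continuous_inv by (auto simp: continuous_map_def)
  moreover have "\<one> \<in> ?V" using W(2) one_in_topspace by simp
  moreover have "sym_invariant_hull ?V \<subseteq> U"
    using U(2) W(3) by (auto simp: sym_invariant_hull_def)
  ultimately show thesis by (rule that)
qed

section \<open>Comparing the topology generated by the sets \<open>U \<gamma>\<close> with the
  finest one\<close>

lemma (in SIN_group) has_local_omega_omega_base_of_finest:
  assumes I: "countable I"
    and F_le: "\<And>i. i \<in> I \<Longrightarrow> \<F> i \<le> principal (carrier G)"
    and F_base: "\<And>i. i \<in> I \<Longrightarrow> admits_omega_omega_base (\<F> i)"
    and finest: "finest_SIN_topology G I \<F> T"
  shows "has_local_omega_omega_base G T"
proof -
  define F where "F = (SUP i\<in>I. \<F> i)"
  have "admits_omega_omega_base F"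
    unfolding F_def using I F_base by (rule admits_omega_omega_base_SUP)
  then obtain B :: "(nat \<Rightarrow> nat) \<Rightarrow> 'a set" where
    B1: "\<And>\<alpha>. \<forall>\<^sub>F x in F. x \<in> B \<alpha>" and
    B2: "\<And>\<alpha> \<beta>. \<alpha> \<le> \<beta> \<Longrightarrow> B \<beta> \<subseteq> B \<alpha>" and
    B3: "\<And>A. \<forall>\<^sub>F x in F. x \<in> A \<Longrightarrow> \<exists>\<alpha>. B \<alpha> \<subseteq> A"
    unfolding admits_omega_omega_base_def by blast
  have F_carrier: "\<forall>\<^sub>F x in F. x \<in> carrier G"
    using F_le by (simp add: F_def eventually_Sup le_principal)
  \<comment> \<open>The supremum is the least upper bound, so the single filter \<open>F\<close>
    replaces the whole family.\<close>
  have conv_iff: "(\<forall>i\<in>I. converges_to_identity G T' (\<F> i)) \<longleftrightarrow> F \<le> nhdsin T' \<one>" for T'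
    by (simp add: F_def converges_to_identity_def SUP_le_iff)
  define C where "C \<alpha> = sym_invariant_hull (B \<alpha>)" for \<alpha>
  have C: "sym_invariant (C \<alpha>)" for \<alpha> by (simp add: C_def sym_invariant_hull)
  have C_anti: "C \<beta> \<subseteq> C \<alpha>" if "\<alpha> \<le> \<beta>" for \<alpha> \<beta>
    unfolding C_def by (intro sym_invariant_hull_mono B2 that)
  define P where "P \<gamma> = partial_set_prod (\<lambda>n. C (\<gamma> n))" for \<gamma> :: "nat \<Rightarrow> nat \<Rightarrow> nat"
  define U where "U \<gamma> = (\<Union>n. P \<gamma> n)" for \<gamma>
  have P_inv: "sym_invariant (P \<gamma> n)" for \<gamma> n
    unfolding P_def by (intro sym_invariant_partial_set_prod C)
  have P_inc: "incseq (P \<gamma>)" for \<gamma>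
    unfolding P_def by (intro incseq_partial_set_prod C)
  have P_anti: "P \<beta> n \<subseteq> P \<gamma> n" if "\<gamma> \<le> \<beta>" for \<beta> \<gamma> n
    unfolding P_def using that by (intro partial_set_prod_mono C_anti) (simp add: le_fun_def)
  have U_anti: "U \<beta> \<subseteq> U \<gamma>" if "\<gamma> \<le> \<beta>" for \<beta> \<gamma>
    using P_anti[OF that] by (auto simp: U_def)
  have U_inv: "sym_invariant (U \<gamma>)" for \<gamma>
    using P_inv[of \<gamma>] unfolding sym_invariant_def U_def by blast
  have U_directed: "\<exists>W\<in>range U. W \<subseteq> V \<inter> V'" if VV: "V \<in> range U" "V' \<in> range U" for V V'
  proof -
    obtain \<beta> \<gamma> where "V = U \<beta>" "V' = U \<gamma>" using VV by blast
    then have "U (sup \<beta> \<gamma>) \<subseteq> V \<inter> V'" using U_anti by simp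
    then show ?thesis by blast
  qed
  have U_square: "\<exists>W\<in>range U. W <#> W \<subseteq> V" if VU: "V \<in> range U" for V
  proof -
    obtain \<gamma> where V: "V = U \<gamma>" using VU by blast
    define \<beta> where "\<beta> n = sup (\<gamma> (2 * n)) (\<gamma> (2 * n + 1))" for n
    have PP: "P \<beta> n <#> P \<beta> n \<subseteq> P \<gamma> (2 * n)" for n
      unfolding P_def by (intro partial_set_prod_mult_subset C C_anti) (simp_all add: \<beta>_def)
    have "x \<otimes> y \<in> U \<gamma>" if xy: "x \<in> U \<beta>" "y \<in> U \<beta>" for x y
    proof -
      obtain m n where "x \<in> P \<beta> m" "y \<in> P \<beta> n" using xy by (auto simp: U_def)
      \<comment> \<open>The two elements may come from different stages of the union; monotonicity
        of \<open>P \<beta>\<close> puts them in a common one.\<close>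
      then have "x \<in> P \<beta> (max m n)" "y \<in> P \<beta> (max m n)"
        using P_inc[of \<beta>] by (meson incseqD max.cobounded1 max.cobounded2 subsetD)+
      then have "x \<otimes> y \<in> P \<gamma> (2 * max m n)" using PP[of "max m n"] by (auto simp: set_mult_def)
      then show ?thesis by (auto simp: U_def)
    qed
    then have "U \<beta> <#> U \<beta> \<subseteq> V" by (auto simp: V set_mult_def)
    then show ?thesis by blast
  qed
  have base: "range U \<noteq> {}" "\<And>V. V \<in> range U \<Longrightarrow> sym_invariant V" using U_inv by auto
  define T' where "T' = topology_of_base (range U)"
  have T': "SIN_group G T'"
    unfolding T'_def by (rule SIN_group_topology_of_base; fact base U_directed U_square)
  have openin_T': "openin T' V \<longleftrightarrow> V \<subseteq> carrier G \<and> (\<forall>x\<in>V. \<exists>W\<in>range U. x <# W \<subseteq> V)" for V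
    unfolding T'_def by (rule openin_topology_of_base; fact base U_directed U_square)
  have "F \<le> nhdsin T' \<one>"
  proof (rule filter_leI)
    fix Q assume "eventually Q (nhdsin T' \<one>)"
    moreover have "\<one> \<in> topspace T'"
      by (rule topological_group.one_in_topspace[OF SIN_group.axioms(1)[OF T']])
    ultimately obtain O' where O': "openin T' O'" "\<one> \<in> O'" "\<forall>x\<in>O'. Q x"
      by (auto simp: eventually_nhdsin)
    then obtain \<gamma> where \<gamma>: "\<one> <# U \<gamma> \<subseteq> O'"
      unfolding openin_T' by blast
    \<comment> \<open>The one-factor product already contains the part of
      \<open>B (\<gamma> 0)\<close> inside the group, which is enough for convergence.\<close>
    have "P \<gamma> 1 = \<one> <# C (\<gamma> 0)"
      by (simp add: P_def set_mult_def l_coset_def)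
    then have P1: "P \<gamma> 1 = C (\<gamma> 0)" using lcos_mult_one[OF sym_invariantD(1)[OF C]] by simp
    have "B (\<gamma> 0) \<inter> carrier G \<subseteq> P \<gamma> 1"
      unfolding P1 C_def by (rule subset_sym_invariant_hull)
    also have "\<dots> \<subseteq> U \<gamma>" by (auto simp: U_def)
    also have "\<dots> \<subseteq> O'" using \<gamma> lcos_mult_one[OF sym_invariantD(1)[OF U_inv]] by simp
    finally have "B (\<gamma> 0) \<inter> carrier G \<subseteq> O'" .
    then show "eventually Q F"
      using O'(3) by (intro eventually_mono[OF eventually_conj[OF B1[of "\<gamma> 0"] F_carrier]]) blast
  qed
  \<comment> \<open>Maximality of \<open>T\<close> enters here: \<open>T'\<close> is now a SIN group
    topology to which every filter of the family converges.\<close>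
  then have finer: "openin T V" if "openin T' V" for V
    using T' finest that unfolding finest_SIN_topology_def conv_iff by blast
  have F_conv: "F \<le> nhdsin T \<one>"
    using finest unfolding finest_SIN_topology_def conv_iff by blast
  have U_nhd: "\<forall>\<^sub>F x in nhdsin T \<one>. x \<in> U \<gamma>" for \<gamma>
  proof -
    obtain V where "openin T' V" "\<one> \<in> V" "V \<subseteq> \<one> <# U \<gamma>"
      unfolding T'_def
      by (rule topology_of_base_nhd[OF base(1) _ base(2) U_square one_closed, of "U \<gamma>"]) (use U_directed in auto)
    then show ?thesis
      using finer lcos_mult_one[OF sym_invariantD(1)[OF U_inv]]
      by (auto simp: eventually_nhdsin one_in_topspace)
  qed
  have U_small: "\<exists>\<gamma>. U \<gamma> \<subseteq> A" if A: "\<forall>\<^sub>F x in nhdsin T \<one>. x \<in> A" for A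
  proof -
    obtain W0 where W0: "openin T W0" "\<one> \<in> W0" "W0 \<subseteq> A"
      using A by (auto simp: eventually_nhdsin one_in_topspace)
    have "\<exists>W. W 0 = W0 \<and> (\<forall>n. (openin T (W n) \<and> \<one> \<in> W n) \<and> W (Suc n) <#> W (Suc n) \<subseteq> W n)"
    proof -
      have sq: "\<exists>V. openin T V \<and> \<one> \<in> V \<and> V <#> V \<subseteq> X" if "openin T X" "\<one> \<in> X" for X
        using square_nhd[OF that] by blast
      \<comment> \<open>The prescribed start \<open>W0\<close> of the chain is carried through
        dependent choice as a clause for \<open>n = 0\<close>.\<close>
      have "\<exists>W. \<forall>n. ((openin T (W n) \<and> \<one> \<in> W n) \<and> (n = 0 \<longrightarrow> W n = W0)) \<and>
          W (Suc n) <#> W (Suc n) \<subseteq> W n"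
        by (rule dependent_nat_choice) (use W0 sq in auto)
      then show ?thesis by blast
    qed
    then obtain W where W: "W 0 = W0" "\<And>n. openin T (W n)" "\<And>n. \<one> \<in> W n"
      "\<And>n. W (Suc n) <#> W (Suc n) \<subseteq> W n" by blast
    have "\<exists>\<alpha>. C \<alpha> \<subseteq> W n" for n
    proof -
      obtain V where V: "openin T V" "\<one> \<in> V" "sym_invariant_hull V \<subseteq> W n"
        using sym_invariant_hull_nhd[OF W(2,3)] .
      have "\<forall>\<^sub>F x in nhdsin T \<one>. x \<in> V"
        using V by (auto simp: eventually_nhdsin one_in_topspace)
      \<comment> \<open>Convergence of \<open>F\<close> in \<open>T\<close> makes the neighbourhood
        \<open>V\<close> a member of \<open>F\<close>, so it contains a base set.\<close>
      then obtain \<alpha> where "B \<alpha> \<subseteq> V" using B3 F_conv filter_leD by blast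
      then show ?thesis using V(3) sym_invariant_hull_mono unfolding C_def by blast
    qed
    then have "\<forall>n. \<exists>\<alpha>. C \<alpha> \<subseteq> W (Suc n)" by blast
    then obtain \<gamma> where "\<forall>n. C (\<gamma> n) \<subseteq> W (Suc n)" by (rule choice[THEN exE])
    then have "P \<gamma> n \<subseteq> W 0" for n
      unfolding P_def using W openin_subset_carrier by (intro partial_set_prod_subset) auto
    then show ?thesis using W(1) W0(3) unfolding U_def by blast
  qed
  \<comment> \<open>Splitting a function into its rows reindexes the base by
    \<open>\<omega>\<^sup>\<omega>\<close>: monotonicity keeps it decreasing, and surjectivity
    ensures that no \<open>U \<gamma>\<close> is lost.\<close>
  define s where "s \<alpha> = (\<lambda>n k. \<alpha> (prod_encode (n, k)))" for \<alpha> :: "nat \<Rightarrow> nat"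
  have s_mono: "s \<alpha> \<le> s \<beta>" if "\<alpha> \<le> \<beta>" for \<alpha> \<beta>
    using that by (simp add: s_def le_fun_def)
  have s_surj: "\<exists>\<alpha>. \<gamma> = s \<alpha>" for \<gamma>
    by (rule exI[of _ "\<lambda>m. case prod_decode m of (n, k) \<Rightarrow> \<gamma> n k"]) (simp add: s_def)
  show ?thesis
    unfolding has_local_omega_omega_base_def admits_omega_omega_base_def
    using U_nhd U_anti[OF s_mono] U_small s_surj by (intro exI[of _ "\<lambda>\<alpha>. U (s \<alpha>)"]) metis
qed

text \<open>Filters live on the ambient type, so being a filter on the group is expressed by
  \<open>\<F> i \<le> principal (carrier G)\<close>.\<close>

theorem theorem3p17:
  fixes G :: "('a, 'b) monoid_scheme" and T :: "'a topology"
    and I :: "'i set" and \<F> :: "'i \<Rightarrow> 'a filter"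
  assumes "SIN_group G T"
    and "countable I"
    and "\<And>i. i \<in> I \<Longrightarrow> \<F> i \<le> principal (carrier G)"
    and "\<And>i. i \<in> I \<Longrightarrow> admits_omega_omega_base (\<F> i)"
    and "finest_SIN_topology G I \<F> T"
  shows "has_local_omega_omega_base G T"
  using assms by (rule SIN_group.has_local_omega_omega_base_of_finest)

end
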